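(* Let $A,B$ be $n\times n$ Hermitian positive definite matrices, and let $A\sharp B := A^{1/2}(A^{-1/2}BA^{-1/2})^{1/2}A^{1/2}$. Then $$A\sharp B=\operatorname*{argmin}_{X>0}\ \left[h(X):=\delta_S^2(X,A)+\delta_S^2(X,B)\right],$$ the minimization being over all $n\times n$ Hermitian positive definite $X$. Moreover, $A\sharp B$ is equidistant from $A$ and $B$, i.e., $\delta_S(A,A\sharp B)=\delta_S(B,A\sharp B)$.
   Context: $X>0$ means $X$ is Hermitian positive definite. For $X,Y>0$, $\delta_S^2(X,Y):=\log\det\left(\frac{X+Y}{2}\right)-\frac12\log\det(XY)$, and $\delta_S$ is its nonnegative square root. *)

theory Defs
  imports Complex_Main
    "Jordan_Normal_Form.Schur_Decomposition"
    "Jordan_Normal_Form.Gauss_Jordan_Elimination"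
    "Jordan_Normal_Form.Determinant"
begin

definition pos_def_mat :: "nat \<Rightarrow> complex mat \<Rightarrow> bool" where
  "pos_def_mat n X \<longleftrightarrow>
     X \<in> carrier_mat n n \<and> mat_adjoint X = X \<and>
     (\<forall>v \<in> carrier_vec n. v \<noteq> 0\<^sub>v n \<longrightarrow> Re ((X *\<^sub>v v) \<bullet>c v) > 0)"

text \<open>The principal square root: for Hermitian positive definite \<open>A\<close>, the unique Hermitian
  positive definite matrix whose square is \<open>A\<close>. Unspecified for other \<open>A\<close>.\<close>

definition mat_sqrt :: "complex mat \<Rightarrow> complex mat" where
  "mat_sqrt A = (THE R. pos_def_mat (dim_row A) R \<and> R * R = A)"

text \<open>Unspecified unless \<open>A\<close> is invertible.\<close>

definition mat_inv :: "complex mat \<Rightarrow> complex mat" where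
  "mat_inv A = the (mat_inverse A)"

definition geom_mean :: "complex mat \<Rightarrow> complex mat \<Rightarrow> complex mat" where
  "geom_mean A B =
     mat_sqrt A *
       mat_sqrt (mat_inv (mat_sqrt A) * B * mat_inv (mat_sqrt A)) *
     mat_sqrt A"

text \<open>For Hermitian positive definite \<open>X\<close> and \<open>Y\<close> both determinants are positive reals, although
  they have type \<^typ>\<open>complex\<close>; hence \<^const>\<open>Re\<close> discards nothing.\<close>

definition delta_S_sq :: "complex mat \<Rightarrow> complex mat \<Rightarrow> real" where
  "delta_S_sq X Y =
     ln (Re (det ((1 / 2) \<cdot>\<^sub>m (X + Y)))) - 1 / 2 * ln (Re (det (X * Y)))"

definition delta_S :: "complex mat \<Rightarrow> complex mat \<Rightarrow> real" where
  "delta_S X Y = sqrt (delta_S_sq X Y)"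

end

theory Submission
  imports Defs
begin

text \<open>
  Put \<open>G = A \<sharp> B\<close>, so that \<open>G A\<inverse> G = B\<close>. For positive definite \<open>X\<close> one has
  \<open>det A \<cdot> det (X + B) = det X \<cdot> det (A + G X\<inverse> G)\<close>, hence up to a constant the objective is
  \<open>log (det (A + X) \<cdot> det (A + G X\<inverse> G))\<close>. The matrix identity
  \<open>A + G X\<inverse> G = (A + G) (A + X)\<inverse> (A + G) + (G - X) (X\<inverse> - (A + X)\<inverse>) (G - X)\<close>
  has a positive semidefinite last term, which vanishes only for \<open>X = G\<close>. Since adding a nonzero
  positive semidefinite matrix strictly increases the determinant of a positive definite one,
  \<open>det (A + X) \<cdot> det (A + G X\<inverse> G) \<ge> (det (A + G))\<^sup>2\<close> with equality exactly for \<open>X = G\<close>.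
  Equidistance follows from the determinant relation at \<open>X = G\<close> and \<open>(det G)\<^sup>2 = det A \<cdot> det B\<close>.
\<close>

section \<open>The spectral theorem for Hermitian matrices\<close>

lemma dim_mat_adjoint [simp]:
  "dim_row (mat_adjoint A) = dim_col A" "dim_col (mat_adjoint A) = dim_row A"
  by (simp_all add: mat_adjoint_def)

lemma mat_adjoint_carrier [simp]:
  "A \<in> carrier_mat m n \<Longrightarrow> mat_adjoint A \<in> carrier_mat n m"
  by (auto intro: carrier_matI)

lemma index_mat_adjoint [simp]:
  fixes A :: "complex mat"
  assumes "i < dim_col A" "j < dim_row A"
  shows "mat_adjoint A $$ (i, j) = cnj (A $$ (j, i))"
  using assms by (simp add: mat_adjoint_def mat_of_rows_index)

lemma mat_adjoint_adjoint [simp]: "mat_adjoint (mat_adjoint A) = (A :: complex mat)"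
  by (rule eq_matI) auto

lemma mat_adjoint_one [simp]: "mat_adjoint (1\<^sub>m n :: complex mat) = 1\<^sub>m n"
  by (rule eq_matI) auto

lemma mat_adjoint_mult:
  fixes A B :: "complex mat"
  assumes "A \<in> carrier_mat m n" "B \<in> carrier_mat n p"
  shows "mat_adjoint (A * B) = mat_adjoint B * mat_adjoint A"
  using assms by (intro eq_matI) (auto simp: scalar_prod_def mult.commute)

lemma mat_adjoint_add:
  fixes A B :: "complex mat"
  assumes "A \<in> carrier_mat m n" "B \<in> carrier_mat m n"
  shows "mat_adjoint (A + B) = mat_adjoint A + mat_adjoint B"
  using assms by (intro eq_matI) auto

lemma mat_adjoint_minus:
  fixes A B :: "complex mat"
  assumes "A \<in> carrier_mat m n" "B \<in> carrier_mat m n"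
  shows "mat_adjoint (A - B) = mat_adjoint A - mat_adjoint B"
  using assms by (intro eq_matI) auto

lemma cscalar_prod_mat_adjoint:
  fixes A :: "complex mat"
  assumes A: "A \<in> carrier_mat m n" and v: "v \<in> carrier_vec n" and w: "w \<in> carrier_vec m"
  shows "(A *\<^sub>v v) \<bullet>c w = v \<bullet>c (mat_adjoint A *\<^sub>v w)"
proof -
  have "(A *\<^sub>v v) \<bullet>c w = (\<Sum>i<m. \<Sum>j<n. A $$ (i, j) * v $ j * cnj (w $ i))"
    using A v w by (simp add: scalar_prod_def sum_distrib_right atLeast0LessThan)
  also have "\<dots> = (\<Sum>j<n. \<Sum>i<m. A $$ (i, j) * v $ j * cnj (w $ i))"
    by (rule sum.swap)
  also have "\<dots> = v \<bullet>c (mat_adjoint A *\<^sub>v w)"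
    using A v w by (simp add: scalar_prod_def sum_distrib_left atLeast0LessThan algebra_simps)
  finally show ?thesis .
qed

lemma cscalar_prod_self:
  fixes v :: "complex vec"
  shows "v \<bullet>c v = complex_of_real (\<Sum>i<dim_vec v. (cmod (v $ i))\<^sup>2)"
  by (simp add: scalar_prod_def atLeast0LessThan flip: complex_norm_square of_real_power)

section \<open>Eigenvectors and unitary completion\<close>

lemma complex_mat_eigenvector_exists:
  fixes A :: "complex mat"
  assumes A: "A \<in> carrier_mat n n" and n: "n \<noteq> 0"
  obtains v e where "v \<in> carrier_vec n" "v \<noteq> 0\<^sub>v n" "A *\<^sub>v v = e \<cdot>\<^sub>v v"
proof -
  obtain as where as: "char_poly A = (\<Prod>a\<leftarrow>as. [:- a, 1:])" "length as = n"
    using char_poly_factorized[OF A] by blast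
  with n obtain e es where "as = e # es" by (cases as) auto
  with as have "poly (char_poly A) e = 0" by simp
  then have "eigenvalue A e"
    by (simp add: eigenvalue_root_char_poly[OF A])
  then show thesis
    using that A unfolding eigenvalue_def eigenvector_def by auto
qed

text \<open>Gram-Schmidt, applied to a basis that starts with \<open>v\<close>, keeps its first
  vector. Normalising the resulting orthogonal family gives the columns of \<open>U\<close>, so
  \<open>c\<close> is the normalising factor of \<open>v\<close>.\<close>

lemma unitary_first_column_exists:
  fixes v :: "complex vec"
  assumes v: "v \<in> carrier_vec n" and v0: "v \<noteq> 0\<^sub>v n" and n: "n \<noteq> 0"
  obtains U c where "U \<in> carrier_mat n n" "mat_adjoint U * U = 1\<^sub>m n" "col U 0 = c \<cdot>\<^sub>v v"
proof -
  interpret cof_vec_space n "TYPE(complex)" .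
  define b where "b = basis_completion v"
  define ws where "ws = gram_schmidt n b"
  from basis_completion[OF v v0, folded b_def]
  have dist_b: "distinct b" and indep: "\<not> lin_dep (set b)" and b: "set b \<subseteq> carrier_vec n"
    and len_b: "length b = n"
    by auto
  have bv: "b = v # tl b" by (simp add: b_def basis_completion_def Let_def)
  from gram_schmidt_result[OF b dist_b indep refl, folded ws_def]
  have ws: "set ws \<subseteq> carrier_vec n" "corthogonal ws" "length ws = n"
    by (auto simp: len_b)
  have "hd ws = v" unfolding ws_def by (subst bv) (rule gram_schmidt_hd[OF v])
  then have ws0: "ws ! 0 = v" using ws(3) n by (metis hd_conv_nth list.size(3))
  have wsc: "ws ! i \<in> carrier_vec n" if "i < n" for i
    using ws that by auto
  \<comment> \<open>\<open>s\<close> is the squared norm and \<open>c\<close> the reciprocal of the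
    norm. Orthogonality in the sense of \<open>corthogonal\<close> includes nonzero self-products,
    so no division by zero occurs on \<open>ws\<close>.\<close>
  define s where "s w = (\<Sum>i<dim_vec w. (cmod (w $ i))\<^sup>2)" for w :: "complex vec"
  define c where "c w = complex_of_real (1 / sqrt (s w))" for w :: "complex vec"
  define U where "U = mat_of_cols n (map (\<lambda>w. c w \<cdot>\<^sub>v w) ws)"
  have U: "U \<in> carrier_mat n n" unfolding U_def using ws(3) by auto
  have col: "col U i = c (ws ! i) \<cdot>\<^sub>v ws ! i" if "i < n" for i
    using that ws wsc unfolding U_def by (subst col_mat_of_cols) auto
  have ent: "(mat_adjoint U * U) $$ (i, j) = (if i = j then 1 else 0)" if ij: "i < n" "j < n" for i j
  proof -
    have "(mat_adjoint U * U) $$ (i, j) = col U j \<bullet>c col U i"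
      using U ij by (simp add: scalar_prod_def mult.commute)
    also have "\<dots> = c (ws ! j) * cnj (c (ws ! i)) * (ws ! j \<bullet>c ws ! i)"
      using wsc[OF ij(1)] wsc[OF ij(2)] ij
      by (simp add: col conjugate_smult_vec)
    also have "\<dots> = (if i = j then 1 else 0)"
    proof (cases "i = j")
      case True
      have e: "ws ! i \<bullet>c ws ! i = complex_of_real (s (ws ! i))"
        unfolding s_def by (rule cscalar_prod_self)
      have "ws ! i \<bullet>c ws ! i \<noteq> 0"
        using corthogonalD[OF ws(2), of i i] ij ws(3) by simp
      moreover have "s (ws ! i) \<ge> 0" unfolding s_def by (simp add: sum_nonneg)
      ultimately have "s (ws ! i) > 0" unfolding e by simp
      then have "c (ws ! i) * cnj (c (ws ! i)) * complex_of_real (s (ws ! i)) = 1"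
        unfolding c_def
        by (simp flip: of_real_mult)
      with True e show ?thesis by simp
    next
      case False
      then show ?thesis using corthogonalD[OF ws(2), of j i] ij ws(3) by simp
    qed
    finally show ?thesis .
  qed
  have "mat_adjoint U * U = 1\<^sub>m n"
    using U by (intro eq_matI) (auto simp: ent simp del: index_mult_mat(1))
  moreover have "col U 0 = c v \<cdot>\<^sub>v v" using col[of 0] n ws0 by simp
  ultimately show thesis using U that by blast
qed

section \<open>Rewrite rules for square matrices of one size\<close>

context
  fixes n :: nat
begin

text \<open>With every dimension fixed to the same \<open>n\<close>, the simplifier has no
  intermediate dimension to guess when it discharges carrier premises.\<close>

lemmas square_mat_carrier =
  mult_carrier_mat[where nr = n and n = n and nc = n]
  minus_carrier_mat[where nr = n and nc = n]
  mult_mat_vec_carrier[where nr = n and n = n]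

lemmas square_mat_assoc = square_mat_carrier
  assoc_mult_mat[where n\<^sub>1 = n and n\<^sub>2 = n and n\<^sub>3 = n and n\<^sub>4 = n]
  assoc_mult_mat_vec[where n\<^sub>1 = n and n\<^sub>2 = n and n\<^sub>3 = n]

lemmas square_mat_distrib = square_mat_carrier
  add_mult_distrib_mat[where nr = n and nc = n and n = n]
  mult_add_distrib_mat[where nr = n and nc = n and n = n]
  minus_mult_distrib_mat[where nr = n and nc = n and n = n]
  mult_minus_distrib_mat[where nr = n and nc = n and n = n]

lemmas square_mat_adjoint =
  mat_adjoint_mult[where m = n and n = n and p = n]
  mat_adjoint_add[where m = n and n = n]
  mat_adjoint_minus[where m = n and n = n]

text \<open>Once products are nested to the right, a cancelling pair inside a longer product occurs
  only in the form \<open>A * (B * C)\<close>; this is the cancellation rule for that normal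
  form.\<close>

lemma mult_cancel_mid:
  assumes "A \<in> carrier_mat n n" "B \<in> carrier_mat n n" "C \<in> carrier_mat n n"
    and "A * B = 1\<^sub>m n"
  shows "A * (B * C) = (C :: complex mat)"
  using assms by (simp flip: assoc_mult_mat[where n\<^sub>1 = n and n\<^sub>2 = n and n\<^sub>3 = n and n\<^sub>4 = n])

end

text \<open>Deflation by induction on the size. Conjugating by a unitary matrix whose first column
  is an eigenvector clears the rest of the first column; being Hermitian clears the rest of the
  first row and makes the eigenvalue real. The remaining block is again Hermitian and falls under
  the induction hypothesis.\<close>

theorem hermitian_spectral:
  fixes A :: "complex mat"
  assumes "A \<in> carrier_mat n n" "mat_adjoint A = A"
  obtains U d where "U \<in> carrier_mat n n" "mat_adjoint U * U = 1\<^sub>m n" "U * mat_adjoint U = 1\<^sub>m n"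
    "A = U * mat_diag n (\<lambda>i. complex_of_real (d i)) * mat_adjoint U"
proof -
  have "\<exists>U d. U \<in> carrier_mat n n \<and> mat_adjoint U * U = 1\<^sub>m n \<and>
      A = U * mat_diag n (\<lambda>i. complex_of_real (d i)) * mat_adjoint U"
    using assms
  proof (induction n arbitrary: A)
    case 0
    then show ?case by (intro exI[of _ "1\<^sub>m 0"] exI[of _ "\<lambda>_. 0"]) (auto intro!: eq_matI)
  next
    case (Suc n)
    let ?N = "Suc n"
    note A = Suc.prems(1)
    obtain v e where v: "v \<in> carrier_vec ?N" "v \<noteq> 0\<^sub>v ?N" and ev: "A *\<^sub>v v = e \<cdot>\<^sub>v v"
      using complex_mat_eigenvector_exists[OF A] by auto
    obtain W c where W: "W \<in> carrier_mat ?N ?N" "mat_adjoint W * W = 1\<^sub>m ?N"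
      and col0: "col W 0 = c \<cdot>\<^sub>v v"
      using unitary_first_column_exists[OF v] by auto
    have W': "W * mat_adjoint W = 1\<^sub>m ?N"
      using mat_mult_left_right_inverse[OF _ W(1) W(2)] W(1) by simp
    define B where "B = mat_adjoint W * A * W"
    have B: "B \<in> carrier_mat ?N ?N" unfolding B_def using A W by auto
    have Bh: "mat_adjoint B = B"
      unfolding B_def using A W Suc.prems(2)
      by (simp add: mat_adjoint_mult[where m = ?N and n = ?N and p = ?N] square_mat_assoc[of _ ?N])
    have "A *\<^sub>v col W 0 = e \<cdot>\<^sub>v col W 0"
      using A v ev by (simp add: col0 mult_mat_vec smult_smult_assoc mult.commute)
    \<comment> \<open>With w the first column of \<open>W\<close>, the first column of
      \<open>B\<close> is \<open>mat_adjoint W\<close> applied to A w = e w, which is e times the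
      first unit vector because \<open>W\<close> is unitary.\<close>
    have "col B 0 = col (mat_adjoint W * (A * W)) 0"
      unfolding B_def using A W by (simp add: square_mat_assoc[of _ ?N])
    also have "\<dots> = mat_adjoint W *\<^sub>v (A *\<^sub>v col W 0)"
      by (simp only: col_mult2[OF mat_adjoint_carrier[OF W(1)] mult_carrier_mat[OF A W(1)] zero_less_Suc]
          col_mult2[OF A W(1) zero_less_Suc])
    also have "\<dots> = e \<cdot>\<^sub>v col (mat_adjoint W * W) 0"
      unfolding \<open>A *\<^sub>v col W 0 = e \<cdot>\<^sub>v col W 0\<close> using W(1) col_carrier_vec[of 0 ?N W ?N]
      by (simp add: mult_mat_vec[where nr = ?N and nc = ?N] col_mult2[where nr = ?N and n = ?N and nc = ?N])
    finally have colB: "col B 0 = e \<cdot>\<^sub>v col (1\<^sub>m ?N) 0" using W(2) by simp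
    have Bi0: "B $$ (i, 0) = (if i = 0 then e else 0)" if "i < ?N" for i
    proof -
      have "B $$ (i, 0) = col B 0 $ i" using that B by simp
      also have "\<dots> = (if i = 0 then e else 0)" unfolding colB using that by (cases "i = 0") (simp_all add: unit_vec_def)
      finally show ?thesis .
    qed
    have Bsym: "B $$ (i, j) = cnj (B $$ (j, i))" if "i < ?N" "j < ?N" for i j
      using B that index_mat_adjoint[of i B j] unfolding Bh by auto
    have B0j: "B $$ (0, j) = (if j = 0 then e else 0)" if "j < ?N" for j
    proof (cases "j = 0")
      case False
      have "B $$ (0, j) = cnj (B $$ (j, 0))" using that by (intro Bsym) auto
      then show ?thesis using False Bi0[OF that] by simp
    qed (simp add: Bi0)
    \<comment> \<open>\<open>e\<close> is a diagonal entry of the Hermitian matrix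
      \<open>B\<close>.\<close>
    have "e = cnj e" using Bsym[of 0 0] unfolding Bi0[OF zero_less_Suc] by simp
    then have e: "e = complex_of_real (Re e)" by (simp add: complex_eq_iff)
    define C where "C = mat n n (\<lambda>(i, j). B $$ (Suc i, Suc j))"
    have C: "C \<in> carrier_mat n n" unfolding C_def by simp
    have "mat_adjoint C = C"
      unfolding C_def by (intro eq_matI) (auto intro!: Bsym[symmetric])
    then obtain V d where V: "V \<in> carrier_mat n n" "mat_adjoint V * V = 1\<^sub>m n"
      and CV: "C = V * mat_diag n (\<lambda>i. complex_of_real (d i)) * mat_adjoint V"
      using Suc.IH[OF C] by blast
    let ?D = "mat_diag n (\<lambda>i. complex_of_real (d i))"
    let ?z1 = "0\<^sub>m 1 n :: complex mat" and ?z2 = "0\<^sub>m n 1 :: complex mat"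
    let ?e = "mat 1 1 (\<lambda>_. e)"
    \<comment> \<open>The diagonalisation of the lower block is extended by a leading 1, and
      \<open>d2\<close> puts the new eigenvalue at index 0, which shifts the old ones by
      one.\<close>
    define V2 where "V2 = four_block_mat (1\<^sub>m 1) ?z1 ?z2 V"
    define d2 where "d2 i = (if i = 0 then Re e else d (i - 1))" for i
    have V2: "V2 \<in> carrier_mat ?N ?N"
      using four_block_carrier_mat[of "1\<^sub>m 1" 1 1 V n n] V unfolding V2_def by simp
    have V2adj: "mat_adjoint V2 = four_block_mat (1\<^sub>m 1) ?z1 ?z2 (mat_adjoint V)"
      using V V2 by (intro eq_matI) (auto simp: V2_def)
    have D2: "mat_diag ?N (\<lambda>i. complex_of_real (d2 i)) = four_block_mat ?e ?z1 ?z2 ?D"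
      using e by (intro eq_matI) (auto simp: mat_diag_def d2_def)
    have Bblock: "B = four_block_mat ?e ?z1 ?z2 C"
      using B Bi0 B0j by (intro eq_matI) (auto simp: C_def)
    have V2u: "mat_adjoint V2 * V2 = 1\<^sub>m ?N"
      unfolding V2adj unfolding V2_def using V
      by (subst mult_four_block_mat[where ?nr1.0 = 1 and ?nr2.0 = n and ?n1.0 = 1 and ?n2.0 = n
            and ?nc1.0 = 1 and ?nc2.0 = n]) auto
    have BV: "B = V2 * mat_diag ?N (\<lambda>i. complex_of_real (d2 i)) * mat_adjoint V2"
    proof -
      note mult = mult_four_block_mat[where ?nr1.0 = 1 and ?nr2.0 = n and ?n1.0 = 1 and ?n2.0 = n
            and ?nc1.0 = 1 and ?nc2.0 = n]
      have D: "?D \<in> carrier_mat n n" by simp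
      have e1: "?e \<in> carrier_mat 1 1" by simp
      have VD: "V * ?D \<in> carrier_mat n n" using V(1) D by (rule mult_carrier_mat)
      have "V2 * four_block_mat ?e ?z1 ?z2 ?D = four_block_mat ?e ?z1 ?z2 (V * ?D)"
        unfolding V2_def using V(1)
        by (subst mult[OF _ _ _ V(1) _ _ _ D])
          (simp_all add: left_mult_zero_mat[OF D] left_mult_one_mat[OF e1] VD right_mult_zero_mat[OF V(1)])
      also have "\<dots> * mat_adjoint V2 = four_block_mat ?e ?z1 ?z2 C"
        unfolding V2adj CV using V(1)
        by (subst mult[OF _ _ _ VD]) (simp_all add: right_mult_zero_mat[OF VD]
            left_add_zero_mat[OF mult_carrier_mat[OF VD mat_adjoint_carrier[OF V(1)]]])
      finally show ?thesis unfolding D2 Bblock by simp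
    qed
    let ?D2 = "mat_diag ?N (\<lambda>i. complex_of_real (d2 i))"
    have "A = W * B * mat_adjoint W"
      unfolding B_def using A W W'
      by (simp add: square_mat_assoc[of _ ?N] mult_cancel_mid[of _ ?N])
    also have "\<dots> = (W * V2) * ?D2 * mat_adjoint (W * V2)"
      unfolding BV using W V2
      by (simp add: square_mat_assoc[of _ ?N] mat_adjoint_mult[where m = ?N and n = ?N and p = ?N])
    finally have "A = (W * V2) * ?D2 * mat_adjoint (W * V2)" .
    moreover have "mat_adjoint (W * V2) * (W * V2) = 1\<^sub>m ?N"
      using W V2 V2u
      by (simp add: square_mat_assoc[of _ ?N] mat_adjoint_mult[where m = ?N and n = ?N and p = ?N]
        mult_cancel_mid[of _ ?N])
    ultimately show ?case using W V2 by (intro exI[of _ "W * V2"] exI[of _ d2]) auto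
  qed
  then obtain U d where U: "U \<in> carrier_mat n n" "mat_adjoint U * U = 1\<^sub>m n"
    and A: "A = U * mat_diag n (\<lambda>i. complex_of_real (d i)) * mat_adjoint U"
    by blast
  have "U * mat_adjoint U = 1\<^sub>m n"
    using mat_mult_left_right_inverse[OF mat_adjoint_carrier[OF U(1)] U] .
  with U A show thesis using that by blast
qed

section \<open>Positive definite matrices\<close>

text \<open>Needed beside \<open>pos_def_mat\<close> because the remainder of the completed square
  is a congruence by \<open>G - X\<close>, which may be singular.\<close>

definition pos_semidef_mat :: "nat \<Rightarrow> complex mat \<Rightarrow> bool" where
  "pos_semidef_mat n X \<longleftrightarrow>
     X \<in> carrier_mat n n \<and> mat_adjoint X = X \<and>
     (\<forall>v \<in> carrier_vec n. Re ((X *\<^sub>v v) \<bullet>c v) \<ge> 0)"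

lemma pos_def_matD:
  assumes "pos_def_mat n X"
  shows "X \<in> carrier_mat n n" "mat_adjoint X = X"
    and "\<And>v. v \<in> carrier_vec n \<Longrightarrow> v \<noteq> 0\<^sub>v n \<Longrightarrow> Re ((X *\<^sub>v v) \<bullet>c v) > 0"
  using assms unfolding pos_def_mat_def by auto

lemma pos_semidef_matD:
  assumes "pos_semidef_mat n X"
  shows "X \<in> carrier_mat n n" "mat_adjoint X = X"
    and "\<And>v. v \<in> carrier_vec n \<Longrightarrow> Re ((X *\<^sub>v v) \<bullet>c v) \<ge> 0"
  using assms unfolding pos_semidef_mat_def by auto

lemma pos_def_imp_semidef:
  assumes "pos_def_mat n X"
  shows "pos_semidef_mat n X"
proof -
  have "Re ((X *\<^sub>v v) \<bullet>c v) \<ge> 0" if "v \<in> carrier_vec n" for v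
    using pos_def_matD[OF assms] that by (cases "v = 0\<^sub>v n") (auto intro: less_imp_le)
  then show ?thesis using assms unfolding pos_semidef_mat_def pos_def_mat_def by auto
qed

lemma pos_def_mat_add:
  assumes X: "pos_def_mat n X" and Y: "pos_semidef_mat n Y"
  shows "pos_def_mat n (X + Y)"
proof -
  note [simp] = pos_def_matD(1,2)[OF X] pos_semidef_matD(1,2)[OF Y]
  have "Re (((X + Y) *\<^sub>v v) \<bullet>c v) > 0" if v: "v \<in> carrier_vec n" "v \<noteq> 0\<^sub>v n" for v
    using pos_def_matD(3)[OF X v] pos_semidef_matD(3)[OF Y v(1)] v(1)
    by (simp add: add_mult_distrib_mat_vec[where nr = n and nc = n] add_scalar_prod_distrib[where n = n]
        square_mat_carrier[of _ n])
  then show ?thesis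
    unfolding pos_def_mat_def by (simp add: mat_adjoint_add[where m = n and n = n])
qed

lemma quadratic_form_congruence:
  fixes C X :: "complex mat"
  assumes C: "C \<in> carrier_mat n n" and X: "X \<in> carrier_mat n n" and v: "v \<in> carrier_vec n"
  shows "((mat_adjoint C * X * C) *\<^sub>v v) \<bullet>c v = (X *\<^sub>v (C *\<^sub>v v)) \<bullet>c (C *\<^sub>v v)"
proof -
  have "(mat_adjoint C * X * C) *\<^sub>v v = mat_adjoint C *\<^sub>v (X *\<^sub>v (C *\<^sub>v v))"
    using assms by (simp add: square_mat_assoc[of _ n])
  then show ?thesis
    using cscalar_prod_mat_adjoint[of "mat_adjoint C" n n "X *\<^sub>v (C *\<^sub>v v)" v] assms by simp
qed

lemma pos_semidef_mat_congruence:
  assumes X: "pos_semidef_mat n X" and C: "C \<in> carrier_mat n n"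
  shows "pos_semidef_mat n (mat_adjoint C * X * C)"
  using pos_semidef_matD[OF X] C quadratic_form_congruence[OF C pos_semidef_matD(1)[OF X]]
  unfolding pos_semidef_mat_def by (simp add: square_mat_adjoint[of _ n] square_mat_assoc[of _ n])

text \<open>A nonzero determinant means that \<open>C\<close> maps nonzero vectors to nonzero
  vectors, so the form of \<open>X\<close> stays strictly positive at
  \<open>C *\<^sub>v v\<close>.\<close>

lemma pos_def_mat_congruence:
  assumes X: "pos_def_mat n X" and C: "C \<in> carrier_mat n n" and det: "det C \<noteq> 0"
  shows "pos_def_mat n (mat_adjoint C * X * C)"
proof -
  have "Re ((X *\<^sub>v (C *\<^sub>v v)) \<bullet>c (C *\<^sub>v v)) > 0" if "v \<in> carrier_vec n" "v \<noteq> 0\<^sub>v n" for v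
    using det that C pos_def_matD(3)[OF X] by (auto simp: det_0_iff_vec_prod_zero_field[OF C])
  then show ?thesis
    using pos_def_matD[OF X] C quadratic_form_congruence[OF C pos_def_matD(1)[OF X]]
    unfolding pos_def_mat_def by (simp add: square_mat_adjoint[of _ n] square_mat_assoc[of _ n])
qed

lemma pos_def_mat_det_nonzero:
  assumes X: "pos_def_mat n X"
  shows "det X \<noteq> 0"
proof
  assume "det X = 0"
  then obtain v where "v \<in> carrier_vec n" "v \<noteq> 0\<^sub>v n" "X *\<^sub>v v = 0\<^sub>v n"
    using det_0_iff_vec_prod_zero_field[OF pos_def_matD(1)[OF X]] by auto
  then show False using pos_def_matD(3)[OF X, of v] by simp
qed

section \<open>Inverses of positive definite matrices\<close>

lemma mat_inv:
  assumes A: "A \<in> carrier_mat n n" and det: "det A \<noteq> 0"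
  shows "mat_inv A \<in> carrier_mat n n" "A * mat_inv A = 1\<^sub>m n" "mat_inv A * A = 1\<^sub>m n"
proof -
  from det_non_zero_imp_unit[OF A det, of "()"] mat_inverse(1)[OF A, of "()"]
  obtain B where "mat_inverse A = Some B" by (cases "mat_inverse A") auto
  with mat_inverse(2)[OF A this]
  show "mat_inv A \<in> carrier_mat n n" "A * mat_inv A = 1\<^sub>m n" "mat_inv A * A = 1\<^sub>m n"
    by (auto simp: mat_inv_def)
qed

lemmas pos_def_mat_inv = mat_inv[OF pos_def_matD(1) pos_def_mat_det_nonzero]

lemma det_mat_inv:
  assumes "A \<in> carrier_mat n n" "det A \<noteq> 0"
  shows "det A * det (mat_inv A) = 1"
  using mat_inv[OF assms] assms by (metis det_mult det_one)

text \<open>Taking the adjoint of X Y = 1 shows that \<open>mat_adjoint ?Y * X\<close> is the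
  identity. Hence \<open>?Y\<close> equals \<open>mat_adjoint ?Y * X * ?Y\<close>, a congruence of
  \<open>X\<close>.\<close>

lemma pos_def_mat_inv_pos_def:
  assumes X: "pos_def_mat n X"
  shows "pos_def_mat n (mat_inv X)"
proof -
  let ?Y = "mat_inv X"
  note c = pos_def_matD(1)[OF X] pos_def_mat_inv(1)[OF X X]
  have "mat_adjoint ?Y * X = mat_adjoint (X * ?Y)"
    using c by (simp add: square_mat_adjoint[of _ n] pos_def_matD(2)[OF X])
  also have "\<dots> = 1\<^sub>m n" using pos_def_mat_inv[OF X X] by simp
  finally have *: "mat_adjoint ?Y * X * ?Y = ?Y" using c by simp
  have "det ?Y \<noteq> 0"
    using det_mat_inv[OF c(1) pos_def_mat_det_nonzero[OF X]] by auto
  from pos_def_mat_congruence[OF X c(2) this] show ?thesis by (simp add: *)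
qed

section \<open>Determinants through diagonalisation\<close>

lemma det_mat_diag: "det (mat_diag n f) = (\<Prod>i<n. f i :: 'a :: comm_ring_1)"
proof -
  have "det (mat_diag n f) = prod_list (diag_mat (mat_diag n f))"
    by (rule det_upper_triangular[where n = n]) (auto simp: mat_diag_def)
  also have "\<dots> = (\<Prod>i<n. f i)"
    by (simp add: prod_list_diag_prod mat_diag_def atLeast0LessThan)
  finally show ?thesis .
qed

lemma det_conj_inverse:
  fixes U :: "complex mat"
  assumes "U \<in> carrier_mat n n" "M \<in> carrier_mat n n" "V \<in> carrier_mat n n" "U * V = 1\<^sub>m n"
  shows "det (U * M * V) = det M"
proof -
  have "det U * det V = 1" using assms by (metis det_mult det_one)
  then show ?thesis using assms by (simp add: det_mult[where n = n])
qed

lemma unitary_diag_eigenvector: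
  fixes U :: "complex mat"
  assumes U: "U \<in> carrier_mat n n" "mat_adjoint U * U = 1\<^sub>m n"
    and A: "A = U * mat_diag n f * mat_adjoint U" and i: "i < n"
  shows "A *\<^sub>v col U i = f i \<cdot>\<^sub>v col U i" "col U i \<bullet>c col U i = 1"
proof -
  have "A * U = U * mat_diag n f"
    using U unfolding A by (simp add: square_mat_assoc[of _ n] right_mult_one_mat[of _ n n])
  then have "col (A * U) i = col (U * mat_diag n f) i" by simp
  then show "A *\<^sub>v col U i = f i \<cdot>\<^sub>v col U i"
    using U(1) i unfolding A mat_diag_mult_right[OF U(1)]
    by (subst (asm) col_mult2[where nr = n and n = n and nc = n]) (auto intro!: eq_vecI simp: mult.commute)
  have "(mat_adjoint U * U) $$ (i, i) = 1" using U(2) i by simp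
  then show "col U i \<bullet>c col U i = 1"
    using U(1) i by (simp add: scalar_prod_def mult.commute)
qed

text \<open>The columns of \<open>U\<close> are unit eigenvectors, so each \<open>d i\<close> is a
  value of the quadratic form. This turns definiteness of \<open>A\<close> into sign conditions on
  the eigenvalues.\<close>

lemma hermitian_spectral_quadratic_form:
  fixes A :: "complex mat"
  assumes "A \<in> carrier_mat n n" "mat_adjoint A = A"
  obtains U d where "U \<in> carrier_mat n n" "mat_adjoint U * U = 1\<^sub>m n" "U * mat_adjoint U = 1\<^sub>m n"
    "A = U * mat_diag n (\<lambda>i. complex_of_real (d i)) * mat_adjoint U"
    "\<And>i. i < n \<Longrightarrow> A *\<^sub>v col U i = complex_of_real (d i) \<cdot>\<^sub>v col U i"
    "\<And>i. i < n \<Longrightarrow> col U i \<noteq> 0\<^sub>v n"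
    "\<And>i. i < n \<Longrightarrow> Re ((A *\<^sub>v col U i) \<bullet>c col U i) = d i"
proof -
  obtain U d where U: "U \<in> carrier_mat n n" "mat_adjoint U * U = 1\<^sub>m n" "U * mat_adjoint U = 1\<^sub>m n"
    and A: "A = U * mat_diag n (\<lambda>i. complex_of_real (d i)) * mat_adjoint U"
    using hermitian_spectral[OF assms] .
  note ev = unitary_diag_eigenvector[OF U(1,2) A]
  show thesis
  proof (rule that[OF U A])
    fix i assume i: "i < n"
    show "A *\<^sub>v col U i = complex_of_real (d i) \<cdot>\<^sub>v col U i" by (rule ev(1)[OF i])
    have c: "col U i \<in> carrier_vec n" using U(1) i by simp
    show "col U i \<noteq> 0\<^sub>v n" using ev(2)[OF i] c by (auto simp del: conjugate_square_eq_0_vec)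
    show "Re ((A *\<^sub>v col U i) \<bullet>c col U i) = d i" unfolding ev(1)[OF i] using ev(2)[OF i] c by simp
  qed
qed

text \<open>The determinant is the product of the eigenvalues, all of them positive. The first
  conclusion allows complex determinant identities to be read as real ones.\<close>

lemma pos_def_mat_det:
  assumes X: "pos_def_mat n X"
  shows "det X = complex_of_real (Re (det X))" "Re (det X) > 0"
proof -
  obtain U d where U: "U \<in> carrier_mat n n" "mat_adjoint U * U = 1\<^sub>m n" "U * mat_adjoint U = 1\<^sub>m n"
    and X': "X = U * mat_diag n (\<lambda>i. complex_of_real (d i)) * mat_adjoint U"
    and "\<And>i. i < n \<Longrightarrow> col U i \<noteq> 0\<^sub>v n"
    and "\<And>i. i < n \<Longrightarrow> Re ((X *\<^sub>v col U i) \<bullet>c col U i) = d i"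
    using hermitian_spectral_quadratic_form[OF pos_def_matD(1,2)[OF X]] by metis
  then have d: "d i > 0" if "i < n" for i
    using pos_def_matD(3)[OF X, of "col U i"] that U(1) by auto
  have "det X = complex_of_real (\<Prod>i<n. d i)"
    unfolding X' using U by (subst det_conj_inverse[where n = n]) (auto simp: det_mat_diag)
  moreover have "(\<Prod>i<n. d i) > 0" using d by (intro prod_pos) auto
  ultimately show "det X = complex_of_real (Re (det X))" "Re (det X) > 0"
    by (simp_all only: Re_complex_of_real)
qed

section \<open>Existence and uniqueness of the positive definite square root\<close>

lemma pos_def_mat_sqrt_exists:
  assumes X: "pos_def_mat n X"
  shows "\<exists>R. pos_def_mat n R \<and> R * R = X"
proof -
  obtain U d where U: "U \<in> carrier_mat n n" "mat_adjoint U * U = 1\<^sub>m n" "U * mat_adjoint U = 1\<^sub>m n"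
    and X': "X = U * mat_diag n (\<lambda>i. complex_of_real (d i)) * mat_adjoint U"
    and "\<And>i. i < n \<Longrightarrow> col U i \<noteq> 0\<^sub>v n"
    and "\<And>i. i < n \<Longrightarrow> Re ((X *\<^sub>v col U i) \<bullet>c col U i) = d i"
    using hermitian_spectral_quadratic_form[OF pos_def_matD(1,2)[OF X]] by metis
  then have d: "d i > 0" if "i < n" for i
    using pos_def_matD(3)[OF X, of "col U i"] that U(1) by auto
  let ?D = "mat_diag n (\<lambda>i. complex_of_real (sqrt (d i)))"
  let ?R = "U * ?D * mat_adjoint U"
  have D2: "?D * ?D = mat_diag n (\<lambda>i. complex_of_real (d i))"
    using d unfolding mat_diag_diag
    by (intro eq_matI) (auto simp: mat_diag_def less_imp_le simp flip: of_real_mult)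
  have "?R * ?R = U * (?D * ?D) * mat_adjoint U"
    using U by (simp add: square_mat_assoc[of _ n] mult_cancel_mid[of _ n] del: mat_diag_diag)
  then have "?R * ?R = X" unfolding D2 X' .
  have pd: "pos_def_mat n ?D"
    unfolding pos_def_mat_def
  proof (intro conjI ballI impI)
    fix v :: "complex vec" assume v: "v \<in> carrier_vec n" "v \<noteq> 0\<^sub>v n"
    have e: "(?D *\<^sub>v v) $ i = complex_of_real (sqrt (d i)) * v $ i" if "i < n" for i
    proof -
      have "(?D *\<^sub>v v) $ i = (\<Sum>j<n. (if i = j then complex_of_real (sqrt (d j)) else 0) * v $ j)"
        using that v(1) by (simp add: mat_diag_def scalar_prod_def atLeast0LessThan)
      also have "\<dots> = (\<Sum>j<n. if i = j then complex_of_real (sqrt (d j)) * v $ j else 0)"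
        by (rule sum.cong) auto
      finally show ?thesis using that by simp
    qed
    have "Re ((?D *\<^sub>v v) \<bullet>c v) = Re (\<Sum>i<n. (?D *\<^sub>v v) $ i * cnj (v $ i))"
      using v(1) by (simp add: scalar_prod_def atLeast0LessThan)
    also have "\<dots> = (\<Sum>i<n. sqrt (d i) * (cmod (v $ i))\<^sup>2)"
      by (simp add: e mult.assoc cmod_power2 power2_eq_square[symmetric] distrib_left)
    also have "\<dots> > 0"
    proof -
      obtain i where i: "i < n" "v $ i \<noteq> 0" using v by (auto simp: vec_eq_iff)
      show ?thesis
      proof (rule sum_pos2[of _ i])
        show "0 < sqrt (d i) * (cmod (v $ i))\<^sup>2" using i d[of i] by simp
        show "0 \<le> sqrt (d j) * (cmod (v $ j))\<^sup>2" if "j \<in> {..<n}" for j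
          using d[of j] that by simp
      qed (use i in auto)
    qed
    finally show "Re ((?D *\<^sub>v v) \<bullet>c v) > 0" .
  qed (auto simp: mat_diag_def intro!: eq_matI)
  \<comment> \<open>\<open>?R\<close> is the congruence of \<open>?D\<close> by
    \<open>mat_adjoint U\<close>, whose own adjoint is \<open>U\<close>.\<close>
  have "det (mat_adjoint U) \<noteq> 0"
    using U by (metis det_mult det_one mat_adjoint_carrier mult_zero_right zero_neq_one)
  from pos_def_mat_congruence[OF pd _ this] U(1) have "pos_def_mat n ?R" by simp
  with \<open>?R * ?R = X\<close> show ?thesis by blast
qed

text \<open>The difference \<open>D\<close> of two square roots satisfies \<open>R D + D S = 0\<close>, which forces every
  eigenvalue of \<open>D\<close> to vanish.\<close>

lemma pos_def_mat_sqrt_unique: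
  assumes R: "pos_def_mat n R" and S: "pos_def_mat n S" and eq: "R * R = S * S"
  shows "R = S"
proof -
  note c = pos_def_matD(1)[OF R] pos_def_matD(1)[OF S]
  let ?D = "R - S"
  have D: "?D \<in> carrier_mat n n" using c by (simp add: minus_carrier_mat)
  have Dh: "mat_adjoint ?D = ?D"
    using c by (simp add: square_mat_adjoint[of _ n] pos_def_matD(2)[OF R] pos_def_matD(2)[OF S])
  obtain U d where U: "U \<in> carrier_mat n n" "mat_adjoint U * U = 1\<^sub>m n" "U * mat_adjoint U = 1\<^sub>m n"
    and DU: "?D = U * mat_diag n (\<lambda>i. complex_of_real (d i)) * mat_adjoint U"
    and ev: "\<And>i. i < n \<Longrightarrow> ?D *\<^sub>v col U i = complex_of_real (d i) \<cdot>\<^sub>v col U i"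
    and nz: "\<And>i. i < n \<Longrightarrow> col U i \<noteq> 0\<^sub>v n"
    using hermitian_spectral_quadratic_form[OF D Dh] by metis
  \<comment> \<open>The mixed products R S cancel. Removing \<open>index_mult_mat(1)\<close> keeps
    entries of products atomic, so that the entrywise comparison is purely additive.\<close>
  have "R * ?D + ?D * S = R * R - S * S"
    using c by (simp add: square_mat_distrib[of _ n]) (intro eq_matI; simp del: index_mult_mat(1))
  then have sylv: "R * ?D + ?D * S = 0\<^sub>m n n" using eq c by (simp add: minus_r_inv_mat[of _ n n])
  \<comment> \<open>Pairing R D + D S = 0 with an eigenvector u of D gives d (<R u, u> + <S u, u>) =
    0, where D moves to the second argument because it is Hermitian. The bracket is
    positive.\<close>
  have "d i = 0" if i: "i < n" for i
  proof -
    let ?u = "col U i"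
    have u: "?u \<in> carrier_vec n" using U(1) i by simp
    have "(R * ?D + ?D * S) *\<^sub>v ?u = R *\<^sub>v (?D *\<^sub>v ?u) + ?D *\<^sub>v (S *\<^sub>v ?u)"
      using c D u by (simp add: add_mult_distrib_mat_vec[where nr = n and nc = n]
          square_mat_assoc[of _ n])
    moreover have "0\<^sub>m n n *\<^sub>v ?u = 0\<^sub>v n" using u by (intro eq_vecI) auto
    ultimately have "0 = (R *\<^sub>v (?D *\<^sub>v ?u) + ?D *\<^sub>v (S *\<^sub>v ?u)) \<bullet>c ?u"
      using u by (metis sylv carrier_vec_conjugate scalar_prod_left_zero)
    also have "\<dots> = (R *\<^sub>v (?D *\<^sub>v ?u)) \<bullet>c ?u + (?D *\<^sub>v (S *\<^sub>v ?u)) \<bullet>c ?u"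
      using c D u by (intro add_scalar_prod_distrib[where n = n]) auto
    also have "(?D *\<^sub>v (S *\<^sub>v ?u)) \<bullet>c ?u = (S *\<^sub>v ?u) \<bullet>c (?D *\<^sub>v ?u)"
      using cscalar_prod_mat_adjoint[OF D, of "S *\<^sub>v ?u" ?u] c u Dh by simp
    also have "(R *\<^sub>v (?D *\<^sub>v ?u)) \<bullet>c ?u = complex_of_real (d i) * ((R *\<^sub>v ?u) \<bullet>c ?u)"
      unfolding ev[OF i] using c u by (simp add: mult_mat_vec[where nr = n and nc = n] square_mat_carrier[of _ n]
          smult_scalar_prod_distrib[where n = n])
    also have "(S *\<^sub>v ?u) \<bullet>c (?D *\<^sub>v ?u) = complex_of_real (d i) * ((S *\<^sub>v ?u) \<bullet>c ?u)"
      unfolding ev[OF i] using c u by (simp add: conjugate_smult_vec scalar_prod_smult_distrib[where n = n])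
    finally have "d i * (Re ((R *\<^sub>v ?u) \<bullet>c ?u) + Re ((S *\<^sub>v ?u) \<bullet>c ?u)) = 0"
      by (simp add: complex_eq_iff distrib_left)
    moreover have "Re ((R *\<^sub>v ?u) \<bullet>c ?u) + Re ((S *\<^sub>v ?u) \<bullet>c ?u) > 0"
      using pos_def_matD(3)[OF R u nz[OF i]] pos_def_matD(3)[OF S u nz[OF i]] by simp
    ultimately show "d i = 0" by simp
  qed
  then have "mat_diag n (\<lambda>i. complex_of_real (d i)) = 0\<^sub>m n n"
    by (intro eq_matI) (auto simp: mat_diag_def)
  then have "?D = 0\<^sub>m n n" using DU U(1) by simp
  then have "?D $$ (i, j) = 0" if "i < n" "j < n" for i j using that by simp
  then show ?thesis using c by (intro eq_matI) auto
qed

lemma mat_sqrt: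
  assumes X: "pos_def_mat n X"
  shows "pos_def_mat n (mat_sqrt X)" "mat_sqrt X * mat_sqrt X = X"
proof -
  have "dim_row X = n" using pos_def_matD(1)[OF X] by simp
  moreover have "\<exists>!R. pos_def_mat n R \<and> R * R = X"
    using pos_def_mat_sqrt_exists[OF X] pos_def_mat_sqrt_unique by blast
  from theI'[OF this] have "pos_def_mat n (THE R. pos_def_mat n R \<and> R * R = X) \<and>
    (THE R. pos_def_mat n R \<and> R * R = X) * (THE R. pos_def_mat n R \<and> R * R = X) = X" .
  ultimately show "pos_def_mat n (mat_sqrt X)" "mat_sqrt X * mat_sqrt X = X"
    by (simp_all add: mat_sqrt_def)
qed

section \<open>Strict monotonicity of the determinant\<close>

text \<open>The eigenvalues of 1 + K are 1 + d_i with d_i \<ge> 0. Their product is at least 1, and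
  it equals 1 only if every d_i vanishes.\<close>

lemma det_one_plus_pos_semidef:
  assumes K: "pos_semidef_mat n K"
  obtains r where "det (1\<^sub>m n + K) = complex_of_real r" "r \<ge> 1" "r = 1 \<Longrightarrow> K = 0\<^sub>m n n"
proof -
  obtain U d where U: "U \<in> carrier_mat n n" "mat_adjoint U * U = 1\<^sub>m n" "U * mat_adjoint U = 1\<^sub>m n"
    and KU: "K = U * mat_diag n (\<lambda>i. complex_of_real (d i)) * mat_adjoint U"
    and "\<And>i. i < n \<Longrightarrow> Re ((K *\<^sub>v col U i) \<bullet>c col U i) = d i"
    using hermitian_spectral_quadratic_form[OF pos_semidef_matD(1,2)[OF K]] by metis
  then have d: "d i \<ge> 0" if "i < n" for i
    using pos_semidef_matD(3)[OF K, of "col U i"] that U(1) by auto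
  let ?D = "mat_diag n (\<lambda>i. complex_of_real (d i))"
  have "1\<^sub>m n + ?D = mat_diag n (\<lambda>i. complex_of_real (1 + d i))"
    by (intro eq_matI) (auto simp: mat_diag_def)
  moreover have "1\<^sub>m n + K = U * (1\<^sub>m n + ?D) * mat_adjoint U"
    unfolding KU using U by (simp add: square_mat_distrib[of _ n])
  ultimately have "1\<^sub>m n + K = U * mat_diag n (\<lambda>i. complex_of_real (1 + d i)) * mat_adjoint U"
    by simp
  then have "det (1\<^sub>m n + K) = complex_of_real (\<Prod>i<n. 1 + d i)"
    using U by (simp add: det_conj_inverse[where n = n] det_mat_diag)
  moreover have "(\<Prod>i<n. 1 + d i) \<ge> 1" using d by (intro prod_ge_1) auto
  moreover have "K = 0\<^sub>m n n" if p: "(\<Prod>i<n. 1 + d i) = 1"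
  proof -
    have "d j = 0" if j: "j < n" for j
    proof -
      \<comment> \<open>Apart from the factor with index \<open>j\<close> the product is at least 1,
        so a total of 1 forces 1 + d_j \<le> 1.\<close>
      have "1 \<le> (\<Prod>i\<in>{..<n} - {j}. 1 + d i)" using d by (intro prod_ge_1) auto
      then have "(1 + d j) * 1 \<le> (1 + d j) * (\<Prod>i\<in>{..<n} - {j}. 1 + d i)"
        using d[OF j] by (intro mult_left_mono) auto
      also have "\<dots> = 1" using prod.remove[of "{..<n}" j "\<lambda>i. 1 + d i"] j p by simp
      finally show ?thesis using d[OF j] by simp
    qed
    then have "?D = 0\<^sub>m n n" by (intro eq_matI) (auto simp: mat_diag_def)
    then show ?thesis unfolding KU using U(1) by simp
  qed
  ultimately show thesis using that by blast
qed

text \<open>With S the square root of H and M = S^-1 K S^-1 one has H + K = S (1 + M) S. This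
  factors det H out and reduces both claims to the case H = 1; M = 0 gives K = S M S = 0.\<close>

lemma det_add_pos_semidef:
  assumes H: "pos_def_mat n H" and K: "pos_semidef_mat n K"
  shows "Re (det H) \<le> Re (det (H + K))"
    and "Re (det (H + K)) = Re (det H) \<Longrightarrow> K = 0\<^sub>m n n"
proof -
  define S where "S = mat_sqrt H"
  have S: "pos_def_mat n S" "S * S = H" unfolding S_def by (rule mat_sqrt[OF H])+
  define T where "T = mat_inv S"
  have T: "pos_def_mat n T" "S * T = 1\<^sub>m n" "T * S = 1\<^sub>m n"
    unfolding T_def using pos_def_mat_inv_pos_def[OF S(1)] pos_def_mat_inv[OF S(1) S(1)] by auto
  note c = pos_def_matD(1)[OF S(1)] pos_def_matD(1)[OF T(1)] pos_semidef_matD(1)[OF K] pos_def_matD(1)[OF H]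
  define M where "M = T * K * T"
  have M: "pos_semidef_mat n M"
    unfolding M_def using pos_semidef_mat_congruence[OF K c(2)] pos_def_matD(2)[OF T(1)] by simp
  note cM = pos_semidef_matD(1)[OF M]
  obtain r where r: "det (1\<^sub>m n + M) = complex_of_real r" "r \<ge> 1"
    and r1: "r = 1 \<Longrightarrow> M = 0\<^sub>m n n"
    using det_one_plus_pos_semidef[OF M] by metis
  have KS: "S * M * S = K"
    unfolding M_def using c T by (simp add: square_mat_assoc[of _ n] mult_cancel_mid[of _ n])
  have "H + K = S * (1\<^sub>m n + M) * S"
    using c cM KS S(2) by (simp add: square_mat_distrib[of _ n])
  then have "det (H + K) = det (S * S) * complex_of_real r"
    using c cM by (simp add: det_mult[where n = n] r(1))
  then have e: "Re (det (H + K)) = Re (det H) * r" unfolding S(2) by simp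
  show "Re (det H) \<le> Re (det (H + K))"
    unfolding e using pos_def_mat_det(2)[OF H] r(2) by simp
  show "K = 0\<^sub>m n n" if "Re (det (H + K)) = Re (det H)"
  proof -
    have "r = 1" using that pos_def_mat_det(2)[OF H] unfolding e by simp
    with r1 KS c show ?thesis by simp
  qed
qed

section \<open>The geometric mean\<close>

text \<open>Write G = S M S with S the square root of A and T = S^-1. Since A^-1 = T T, the inner
  factors cancel and G A^-1 G = S M M S = S T B T S = B. Later arguments use only this equation and
  the definiteness of G, never the explicit formula.\<close>

lemma geom_mean:
  assumes A: "pos_def_mat n A" and B: "pos_def_mat n B"
  shows "pos_def_mat n (geom_mean A B)" "geom_mean A B * mat_inv A * geom_mean A B = B"
proof -
  define S where "S = mat_sqrt A"
  define T where "T = mat_inv S"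
  define M where "M = mat_sqrt (T * B * T)"
  have G: "geom_mean A B = S * M * S" by (simp add: geom_mean_def S_def T_def M_def)
  have S: "pos_def_mat n S" "S * S = A" unfolding S_def by (rule mat_sqrt[OF A])+
  have T: "pos_def_mat n T" "S * T = 1\<^sub>m n" "T * S = 1\<^sub>m n"
    unfolding T_def using pos_def_mat_inv_pos_def[OF S(1)] pos_def_mat_inv[OF S(1) S(1)] by auto
  have "pos_def_mat n (T * B * T)"
    using pos_def_mat_congruence[OF B pos_def_matD(1)[OF T(1)] pos_def_mat_det_nonzero[OF T(1)]]
    by (simp add: pos_def_matD(2)[OF T(1)])
  from mat_sqrt[OF this] have M: "pos_def_mat n M" "M * M = T * B * T" unfolding M_def .
  show "pos_def_mat n (geom_mean A B)"
    using pos_def_mat_congruence[OF M(1) pos_def_matD(1)[OF S(1)] pos_def_mat_det_nonzero[OF S(1)]]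
    by (simp add: G pos_def_matD(2)[OF S(1)])
  note c = pos_def_matD(1)[OF S(1)] pos_def_matD(1)[OF T(1)] pos_def_matD(1)[OF M(1)]
    pos_def_matD(1)[OF A] pos_def_matD(1)[OF B] pos_def_mat_inv(1)[OF A A]
  \<comment> \<open>Multiplying A^-1 S S = 1 by T T on the right identifies A^-1 with T T.\<close>
  have "mat_inv A * (S * S) = 1\<^sub>m n" using pos_def_mat_inv[OF A A] S(2) by simp
  then have "mat_inv A * (S * S) * (T * T) = T * T" using c by simp
  then have inv: "mat_inv A = T * T"
    using c T by (simp add: square_mat_assoc[of _ n] mult_cancel_mid[of _ n])
  have "S * M * S * (T * T) * (S * M * S) = S * (M * M) * S"
    using c T by (simp add: square_mat_assoc[of _ n] mult_cancel_mid[of _ n])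
  also have "\<dots> = B"
    unfolding M(2) using c T by (simp add: square_mat_assoc[of _ n] mult_cancel_mid[of _ n])
  finally show "geom_mean A B * mat_inv A * geom_mean A B = B" unfolding G inv .
qed

section \<open>The determinant inequality by completing the square\<close>

lemma eq_minus_mat:
  fixes A B :: "'a :: ab_group_add mat"
  assumes "A \<in> carrier_mat nr nc" "B \<in> carrier_mat nr nc" "A + B = C"
  shows "A = C - B"
  using assms by (intro eq_matI) auto

text \<open>Completing the square in the form behind Hua's determinant inequality.\<close>

lemma add_congruence_inv_completion:
  assumes A: "pos_def_mat n A" and X: "pos_def_mat n X" and G: "G \<in> carrier_mat n n"
  shows "A + G * mat_inv X * G =
    (A + G) * mat_inv (A + X) * (A + G) + (G - X) * (mat_inv X - mat_inv (A + X)) * (G - X)"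
proof -
  define Y where "Y = mat_inv X"
  define T where "T = mat_inv (A + X)"
  have AX: "pos_def_mat n (A + X)" using pos_def_mat_add[OF A pos_def_imp_semidef[OF X]] .
  note c = pos_def_matD(1)[OF A] pos_def_matD(1)[OF X] G
  have Y: "Y \<in> carrier_mat n n" "X * Y = 1\<^sub>m n" "Y * X = 1\<^sub>m n"
    unfolding Y_def using pos_def_mat_inv[OF X X] by auto
  have T: "T \<in> carrier_mat n n" "(A + X) * T = 1\<^sub>m n" "T * (A + X) = 1\<^sub>m n"
    unfolding T_def using pos_def_mat_inv[OF AX AX] by auto
  have "A * T + X * T = 1\<^sub>m n" "T * A + T * X = 1\<^sub>m n"
    using T c by (simp_all add: square_mat_distrib[of _ n])
  \<comment> \<open>These equations eliminate \<open>A\<close> wherever it stands next to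
    \<open>T\<close>; \<open>AT'\<close> is the same rule inside right-nested products. Afterwards
    both sides are sums of the same products and agree entrywise.\<close>
  then have AT: "A * T = 1\<^sub>m n - X * T" and TA: "T * A = 1\<^sub>m n - T * X"
    using T(1) c
    by (auto intro!: eq_minus_mat[where nr = n and nc = n] simp: square_mat_carrier[of _ n])
  have AT': "A * (T * Z) = Z - X * (T * Z)" if "Z \<in> carrier_mat n n" for Z
  proof -
    have "A * (T * Z) = A * T * Z" using c T that by simp
    then show ?thesis using c T that
      by (simp add: AT square_mat_distrib[of _ n] square_mat_assoc[of _ n])
  qed
  have XY': "X * (Y * Z) = Z" if "Z \<in> carrier_mat n n" for Z
    using mult_cancel_mid[OF c(2) Y(1) that Y(2)] .
  show ?thesis
    unfolding Y_def[symmetric] T_def[symmetric]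
    using c T(1) Y
    by (simp add: square_mat_distrib[of _ n] square_mat_assoc[of _ n] AT' XY' AT TA)
      (intro eq_matI; simp del: index_mult_mat(1))
qed

text \<open>Multiplying the difference by A + X on both sides gives (A + X) X^-1 (A + X) - (A + X) =
  A + A X^-1 A, which is positive definite. Congruence by (A + X)^-1 leads back.\<close>

lemma pos_def_mat_inv_minus_inv_add:
  assumes A: "pos_def_mat n A" and X: "pos_def_mat n X"
  shows "pos_def_mat n (mat_inv X - mat_inv (A + X))"
proof -
  define Y where "Y = mat_inv X"
  define T where "T = mat_inv (A + X)"
  define W where "W = Y - T"
  have AX: "pos_def_mat n (A + X)" using pos_def_mat_add[OF A pos_def_imp_semidef[OF X]] .
  note c = pos_def_matD(1)[OF A] pos_def_matD(1)[OF X]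
  have Y: "Y \<in> carrier_mat n n" "X * Y = 1\<^sub>m n" "Y * X = 1\<^sub>m n"
    unfolding Y_def using pos_def_mat_inv[OF X X] by auto
  have T: "T \<in> carrier_mat n n" "(A + X) * T = 1\<^sub>m n" "T * (A + X) = 1\<^sub>m n"
    unfolding T_def using pos_def_mat_inv[OF AX AX] by auto
  have Tpd: "pos_def_mat n T" unfolding T_def by (rule pos_def_mat_inv_pos_def[OF AX])
  have cs: "A + X \<in> carrier_mat n n" "W \<in> carrier_mat n n"
    using c T Y by (simp_all add: W_def square_mat_carrier[of _ n])
  have "(A + X) * W * (A + X) = (A + X) * Y * (A + X) - (A + X) * T * (A + X)"
    unfolding W_def using cs(1) T(1) Y(1) by (simp add: square_mat_distrib[of _ n])
  also have "(A + X) * T * (A + X) = A + X" using T(2) left_mult_one_mat[OF cs(1)] by simp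
  also have "(A + X) * Y * (A + X) = A * Y * A + A + A + X"
    using c Y by (simp add: square_mat_distrib[of _ n] square_mat_assoc[of _ n])
      (intro eq_matI; simp del: index_mult_mat(1))
  also have "A * Y * A + A + A + X - (A + X) = A + A * Y * A"
    using c Y by (intro eq_matI) (simp_all del: index_mult_mat(1))
  finally have "T * ((A + X) * W * (A + X)) * T = T * (A + A * Y * A) * T" by simp
  moreover have "T * ((A + X) * W * (A + X)) * T = W"
    using cs T by (simp add: square_mat_assoc[of _ n] mult_cancel_mid[of _ n])
  ultimately have W: "W = T * (A + A * Y * A) * T" by simp
  have "pos_semidef_mat n (A * Y * A)"
    using pos_semidef_mat_congruence[OF pos_def_imp_semidef[OF pos_def_mat_inv_pos_def[OF X]] c(1)]
    by (simp add: Y_def pos_def_matD(2)[OF A])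
  from pos_def_mat_congruence[OF pos_def_mat_add[OF A this] T(1) pos_def_mat_det_nonzero[OF Tpd]]
  show ?thesis unfolding Y_def[symmetric] T_def[symmetric] W_def[symmetric]
    by (simp add: W pos_def_matD(2)[OF Tpd])
qed

text \<open>The form of the congruence at the j-th unit vector is the form of W at the j-th column
  of C, so a nonzero column would give a positive value.\<close>

lemma pos_def_mat_congruence_eq_0:
  assumes W: "pos_def_mat n W" and C: "C \<in> carrier_mat n n"
    and 0: "mat_adjoint C * W * C = 0\<^sub>m n n"
  shows "C = 0\<^sub>m n n"
proof -
  have "col C j = 0\<^sub>v n" if j: "j < n" for j
  proof (rule ccontr)
    assume nz: "col C j \<noteq> 0\<^sub>v n"
    have e: "C *\<^sub>v unit_vec n j = col C j"
      using C j by (intro eq_vecI) auto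
    have "(W *\<^sub>v col C j) \<bullet>c col C j = (0\<^sub>m n n *\<^sub>v unit_vec n j) \<bullet>c unit_vec n j"
      using quadratic_form_congruence[OF C pos_def_matD(1)[OF W], of "unit_vec n j"]
      unfolding 0 e by simp
    also have "0\<^sub>m n n *\<^sub>v unit_vec n j = (0\<^sub>v n :: complex vec)" by (intro eq_vecI) auto
    also have "0\<^sub>v n \<bullet>c unit_vec n j = (0 :: complex)" by simp
    finally have "(W *\<^sub>v col C j) \<bullet>c col C j = 0" .
    moreover have "Re ((W *\<^sub>v col C j) \<bullet>c col C j) > 0"
      using pos_def_matD(3)[OF W _ nz] C j by simp
    ultimately show False by simp
  qed
  then have "col C j $ i = 0" if "i < n" "j < n" for i j using that by simp
  then show ?thesis using C by (intro eq_matI) auto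
qed

text \<open>In the completed square H + K, the leading term satisfies det (A + X) det H = (det (A +
  G))^2, so the bound is the monotonicity of the determinant under adding K. Equality forces K = 0,
  and then G - X = 0 because the middle factor W is definite.\<close>

lemma det_add_congruence_inv:
  assumes A: "pos_def_mat n A" and X: "pos_def_mat n X" and G: "pos_def_mat n G"
  shows "(Re (det (A + G)))\<^sup>2 \<le> Re (det (A + X)) * Re (det (A + G * mat_inv X * G))"
    and "Re (det (A + X)) * Re (det (A + G * mat_inv X * G)) = (Re (det (A + G)))\<^sup>2 \<Longrightarrow> X = G"
proof -
  define W where "W = mat_inv X - mat_inv (A + X)"
  define H where "H = (A + G) * mat_inv (A + X) * (A + G)"
  define K where "K = (G - X) * W * (G - X)"
  have AX: "pos_def_mat n (A + X)" using pos_def_mat_add[OF A pos_def_imp_semidef[OF X]] .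
  have AG: "pos_def_mat n (A + G)" using pos_def_mat_add[OF A pos_def_imp_semidef[OF G]] .
  note c = pos_def_matD(1)[OF X] pos_def_matD(1)[OF G]
    pos_def_matD(1)[OF AG] pos_def_mat_inv(1)[OF AX AX]
  have W: "pos_def_mat n W" unfolding W_def by (rule pos_def_mat_inv_minus_inv_add[OF A X])
  have H: "pos_def_mat n H"
    using pos_def_mat_congruence[OF pos_def_mat_inv_pos_def[OF AX] c(3) pos_def_mat_det_nonzero[OF AG]]
    by (simp add: H_def pos_def_matD(2)[OF AG])
  have GX: "G - X \<in> carrier_mat n n" "mat_adjoint (G - X) = G - X"
    using c by (simp_all add: minus_carrier_mat mat_adjoint_minus[where m = n and n = n]
        pos_def_matD(2)[OF X] pos_def_matD(2)[OF G])
  have K: "pos_semidef_mat n K"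
    using pos_semidef_mat_congruence[OF pos_def_imp_semidef[OF W] GX(1)] by (simp add: K_def GX(2))
  have HK: "A + G * mat_inv X * G = H + K"
    unfolding H_def K_def W_def by (rule add_congruence_inv_completion[OF A X c(2)])
  have "det (A + X) * det H = (det (A + X) * det (mat_inv (A + X))) * (det (A + G))\<^sup>2"
    unfolding H_def using c by (simp add: det_mult[where n = n] square_mat_carrier[of _ n] power2_eq_square)
  also have "\<dots> = (det (A + G))\<^sup>2"
    by (simp add: det_mat_inv[OF pos_def_matD(1)[OF AX] pos_def_mat_det_nonzero[OF AX]])
  finally have "complex_of_real (Re (det (A + X)) * Re (det H)) = complex_of_real ((Re (det (A + G)))\<^sup>2)"
    using pos_def_mat_det(1)[OF AX] pos_def_mat_det(1)[OF H] pos_def_mat_det(1)[OF AG] by simp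
  then have e: "(Re (det (A + G)))\<^sup>2 = Re (det (A + X)) * Re (det H)"
    unfolding of_real_eq_iff by simp
  show "(Re (det (A + G)))\<^sup>2 \<le> Re (det (A + X)) * Re (det (A + G * mat_inv X * G))"
    unfolding e HK using det_add_pos_semidef(1)[OF H K] pos_def_mat_det(2)[OF AX]
    by (simp add: mult_left_mono)
  show "X = G" if "Re (det (A + X)) * Re (det (A + G * mat_inv X * G)) = (Re (det (A + G)))\<^sup>2"
  proof -
    have "Re (det (H + K)) = Re (det H)"
      using that pos_def_mat_det(2)[OF AX] unfolding e HK by simp
    then have "mat_adjoint (G - X) * W * (G - X) = 0\<^sub>m n n"
      using det_add_pos_semidef(2)[OF H K] unfolding GX(2) K_def by simp
    from pos_def_mat_congruence_eq_0[OF W GX(1) this]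
    have "(G - X) $$ (i, j) = 0" if "i < n" "j < n" for i j using that by simp
    then show ?thesis using c by (intro eq_matI) auto
  qed
qed

section \<open>From determinants to the objective\<close>

text \<open>Multiplying X + G A^-1 G by A G^-1 on the left, or A + G X^-1 G by G^-1 X on the right,
  gives the same matrix A G^-1 X + G. Taking determinants and cancelling det G^-1 yields the
  claim.\<close>

lemma det_add_swap_inv:
  assumes A: "pos_def_mat n A" and X: "pos_def_mat n X" and G: "pos_def_mat n G"
  shows "det A * det (X + G * mat_inv A * G) = det X * det (A + G * mat_inv X * G)"
proof -
  let ?F = "mat_inv G"
  note c = pos_def_matD(1)[OF A] pos_def_matD(1)[OF X] pos_def_matD(1)[OF G]
    pos_def_mat_inv(1)[OF A A] pos_def_mat_inv(1)[OF X X] pos_def_mat_inv(1)[OF G G]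
  have "A * ?F * (X + G * mat_inv A * G) = A * ?F * X + G"
    using c pos_def_mat_inv(2,3)[OF A A] pos_def_mat_inv(2,3)[OF G G]
    by (simp add: square_mat_distrib[of _ n] square_mat_assoc[of _ n] mult_cancel_mid[of _ n])
  moreover have "(A + G * mat_inv X * G) * ?F * X = A * ?F * X + G"
    using c pos_def_mat_inv(2,3)[OF X X] pos_def_mat_inv(2,3)[OF G G]
    by (simp add: square_mat_distrib[of _ n] square_mat_assoc[of _ n] mult_cancel_mid[of _ n])
  ultimately have "det (A * ?F * (X + G * mat_inv A * G)) = det ((A + G * mat_inv X * G) * ?F * X)"
    by simp
  moreover have "det (A * ?F * (X + G * mat_inv A * G)) = det A * det ?F * det (X + G * mat_inv A * G)"
    using c by (simp add: det_mult[where n = n] square_mat_carrier[of _ n] del: assoc_mult_mat)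
  moreover have "det ((A + G * mat_inv X * G) * ?F * X) = det (A + G * mat_inv X * G) * det ?F * det X"
    using c by (simp add: det_mult[where n = n] square_mat_carrier[of _ n] del: assoc_mult_mat)
  moreover have "det ?F \<noteq> 0" using pos_def_mat_det_nonzero[OF pos_def_mat_inv_pos_def[OF G]] .
  ultimately show ?thesis by simp
qed

text \<open>The scalar 1/2 contributes (1/2)^n to the determinant, hence the term n ln 2; the
  logarithms split because all determinants involved are positive reals.\<close>

lemma delta_S_sq_eq:
  assumes X: "pos_def_mat n X" and Y: "pos_def_mat n Y"
  shows "delta_S_sq X Y =
    ln (Re (det (X + Y))) - real n * ln 2 - ln (Re (det X)) / 2 - ln (Re (det Y)) / 2"
proof -
  have XY: "pos_def_mat n (X + Y)" using pos_def_mat_add[OF X pos_def_imp_semidef[OF Y]] .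
  note c = pos_def_matD(1)[OF X] pos_def_matD(1)[OF Y] pos_def_matD(1)[OF XY]
  note d = pos_def_mat_det[OF X] pos_def_mat_det[OF Y] pos_def_mat_det[OF XY]
  have "det ((1 / 2) \<cdot>\<^sub>m (X + Y)) = complex_of_real ((1 / 2) ^ n * Re (det (X + Y)))"
    using c d(5) by simp
  then have 1: "Re (det ((1 / 2) \<cdot>\<^sub>m (X + Y))) = (1 / 2) ^ n * Re (det (X + Y))"
    by (simp only: Re_complex_of_real)
  have "det (X * Y) = complex_of_real (Re (det X) * Re (det Y))"
    using c d(1,3) by (simp add: det_mult[where n = n])
  then have 2: "Re (det (X * Y)) = Re (det X) * Re (det Y)"
    by (simp only: Re_complex_of_real)
  show ?thesis
    unfolding delta_S_sq_def 1 2 using d(2,4,6)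
    by (simp add: ln_mult ln_realpow ln_div field_simps)
qed

text \<open>Equality of the set of minimisers with a singleton expresses attainment and uniqueness
  together.\<close>

theorem theorem4p1:
  fixes n :: nat and A B :: "complex mat"
  assumes "pos_def_mat n A" and "pos_def_mat n B"
  shows "{X. is_arg_min (\<lambda>X. delta_S_sq X A + delta_S_sq X B) (pos_def_mat n) X} = {geom_mean A B}
    \<and> delta_S A (geom_mean A B) = delta_S B (geom_mean A B)"
proof -
  note A = assms(1) and B = assms(2)
  define G where "G = geom_mean A B"
  have G: "pos_def_mat n G" and GB: "G * mat_inv A * G = B"
    unfolding G_def by (rule geom_mean[OF A B])+
  note cG = pos_def_matD(1)[OF G] and cA = pos_def_matD(1)[OF A]
  define d where "d X = Re (det X)" for X :: "complex mat"
  have add: "pos_def_mat n (X + Y)" if "pos_def_mat n X" "pos_def_mat n Y" for X Y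
    using pos_def_mat_add[OF that(1) pos_def_imp_semidef[OF that(2)]] .
  have d_pos: "d X > 0" if "pos_def_mat n X" for X
    unfolding d_def by (rule pos_def_mat_det(2)[OF that])
  have of_d: "det X = complex_of_real (d X)" if "pos_def_mat n X" for X
    unfolding d_def by (rule pos_def_mat_det(1)[OF that])
  have pd: "pos_def_mat n (A + G * mat_inv X * G)" if X: "pos_def_mat n X" for X
    using add[OF A pos_def_mat_congruence[OF pos_def_mat_inv_pos_def[OF X] cG pos_def_mat_det_nonzero[OF G]]]
    by (simp add: pos_def_matD(2)[OF G])
  \<comment> \<open>Here G A^-1 G is replaced by B, which trades det (X + B) for a determinant that
    the inequality controls.\<close>
  have swap: "ln (d (X + B)) = ln (d X) + ln (d (A + G * mat_inv X * G)) - ln (d A)"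
    if X: "pos_def_mat n X" for X
  proof -
    have "complex_of_real (d A * d (X + B)) = complex_of_real (d X * d (A + G * mat_inv X * G))"
      using det_add_swap_inv[OF A X G] of_d[OF A] of_d[OF X] of_d[OF add[OF X B]] of_d[OF pd[OF X]]
      unfolding GB by simp
    then have "d A * d (X + B) = d X * d (A + G * mat_inv X * G)" unfolding of_real_eq_iff .
    then have "ln (d A * d (X + B)) = ln (d X * d (A + G * mat_inv X * G))" by simp
    then show ?thesis
      using d_pos[OF A] d_pos[OF X] d_pos[OF add[OF X B]] d_pos[OF pd[OF X]] by (simp add: ln_mult)
  qed
  \<comment> \<open>\<open>m\<close> collects what does not depend on X: n ln 2 twice, half of ln
    det A and of ln det B from the two distances, and one further ln det A from \<open>swap\<close>.
    The two halves of -ln det X cancel against the ln det X of \<open>swap\<close>.\<close>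
  define m where "m = - 2 * real n * ln 2 - 3 / 2 * ln (d A) - ln (d B) / 2"
  let ?h = "\<lambda>X. delta_S_sq X A + delta_S_sq X B"
  have h: "?h X = ln (d (A + X) * d (A + G * mat_inv X * G)) + m" if X: "pos_def_mat n X" for X
  proof -
    have "X + A = A + X" using pos_def_matD(1)[OF X] cA by (simp add: comm_add_mat[where nr = n and nc = n])
    then show ?thesis
      using swap[OF X] d_pos[OF add[OF A X]] d_pos[OF pd[OF X]]
      unfolding delta_S_sq_eq[OF X A] delta_S_sq_eq[OF X B] d_def[symmetric] m_def
      by (simp add: ln_mult field_simps)
  qed
  \<comment> \<open>At X = G the second determinant becomes det (A + G), so the product is exactly
    the lower bound.\<close>
  have GG: "G * mat_inv G * G = G" using pos_def_mat_inv[OF G G] cG by simp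
  have hG: "?h G = ln ((d (A + G))\<^sup>2) + m" using h[OF G] by (simp add: GG power2_eq_square)
  have le: "?h G \<le> ?h X" and eq: "?h X = ?h G \<Longrightarrow> X = G" if X: "pos_def_mat n X" for X
  proof -
    have pos: "(d (A + G))\<^sup>2 > 0" "d (A + X) * d (A + G * mat_inv X * G) > 0"
      using d_pos[OF add[OF A G]] d_pos[OF add[OF A X]] d_pos[OF pd[OF X]] by auto
    show "?h G \<le> ?h X"
      unfolding hG h[OF X] using det_add_congruence_inv(1)[OF A X G] pos by (simp add: d_def)
    show "X = G" if "?h X = ?h G"
      using that det_add_congruence_inv(2)[OF A X G] pos unfolding hG h[OF X] by (simp add: d_def)
  qed
  have "{X. is_arg_min ?h (pos_def_mat n) X} = {G}"
  proof (intro equalityI subsetI)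
    fix X assume "X \<in> {X. is_arg_min ?h (pos_def_mat n) X}"
    then have X: "pos_def_mat n X" and "\<not> ?h G < ?h X" using G by (auto simp: is_arg_min_def)
    with le[OF X] have "?h X = ?h G" by linarith
    then show "X \<in> {G}" using eq[OF X] by blast
  next
    fix X assume "X \<in> {G}"
    then show "X \<in> {X. is_arg_min ?h (pos_def_mat n) X}"
      using G le by (auto simp: is_arg_min_def not_less)
  qed
  moreover have "delta_S A G = delta_S B G"
  proof -
    have pos: "d A > 0" "d B > 0" "d G > 0"
      using d_pos A B G by auto
    \<comment> \<open>Determinants of G A^-1 G = B: det G is the geometric mean of det A and det
      B.\<close>
    have "det A * det B = (det A * det (mat_inv A)) * (det G * det G)"
      using cG pos_def_mat_inv(1)[OF A A]
      by (subst GB[symmetric]) (simp add: det_mult[where n = n] square_mat_carrier[of _ n])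
    also have "\<dots> = det G * det G"
      by (simp only: det_mat_inv[OF cA pos_def_mat_det_nonzero[OF A]] mult_1)
    finally have "complex_of_real (d A * d B) = complex_of_real (d G * d G)"
      using of_d A B G by simp
    then have "d A * d B = d G * d G" unfolding of_real_eq_iff .
    then have "ln (d A * d B) = ln (d G * d G)" by simp
    then have "ln (d A) + ln (d B) = 2 * ln (d G)"
      using pos by (simp add: ln_mult)
    moreover have "B + G = G + B"
      using pos_def_matD(1)[OF B] cG by (simp add: comm_add_mat[where nr = n and nc = n])
    \<comment> \<open>By \<open>swap\<close> at G, ln det (G + B) - ln det (A + G) = ln det G - ln
      det A = (ln det B - ln det A) / 2, which is exactly the difference of the half-logarithm
      terms.\<close>
    ultimately have "delta_S_sq A G = delta_S_sq B G"
      using swap[OF G] unfolding delta_S_sq_eq[OF A G] delta_S_sq_eq[OF B G] d_def[symmetric] GG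
      by (simp add: field_simps)
    then show ?thesis by (simp add: delta_S_def)
  qed
  ultimately show ?thesis unfolding G_def by simp
qed

end
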